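(* Let $p,q\ge1$ and let $(\mathcal{X}\times\Omega,d_{\mathcal{X}},\mu)$, $(\mathcal{Y}\times\Omega,d_{\mathcal{Y}},\nu)$ belong to $\mathbb{S}_{pq}(\Omega)$, with feature marginals $\mu_A,\nu_B$ and structure marginals $\mu_X,\nu_Y$. Then $$\lim_{\alpha\to0}FGW_{\alpha,p,q}(\mu,\nu)=\big(W_{pq}(\mu_A,\nu_B)\big)^q,\qquad \lim_{\alpha\to1}FGW_{\alpha,p,q}(\mu,\nu)=\big(GW_{pq}(\mu_X,\nu_Y)\big)^q .$$
   Context: All metric spaces are complete and separable. A structured object over $(\Omega,d)$ is a triplet $(\mathcal{X}\times\Omega,d_{\mathcal{X}},\mu)$ with $(\mathcal{X},d_{\mathcal{X}})$ a metric space and $\mu$ a Borel probability measure on $\mathcal{X}\times\Omega$, with marginals $\mu_X$ on $\mathcal{X}$ and $\mu_A$ on $\Omega$. It belongs to $\mathbb{S}_r(\Omega)$ if $\int d(a,a_0)^r d\mu_A(a)<\infty$ for some $a_0\in\Omega$ and $\iint d_{\mathcal{X}}(x,x')^r d\mu_X(x)d\mu_X(x')<\infty$. For $\alpha\in[0,1]$, $$FGW_{\alpha,p,q}(\mu,\nu)=\Big(\inf_{\pi\in\Pi(\mu,\nu)}\iint\big((1-\alpha)d(a,b)^q+\alpha|d_{\mathcal{X}}(x,x')-d_{\mathcal{Y}}(y,y')|^q\big)^p d\pi((x,a),(y,b))d\pi((x',a'),(y',b'))\Big)^{1/p},$$ where $\Pi(\mu,\nu)$ is the set of couplings. For $r\ge1$,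 $W_r(\mu_A,\nu_B)=\big(\inf_{\pi\in\Pi(\mu_A,\nu_B)}\int d(a,b)^r d\pi(a,b)\big)^{1/r}$ and $GW_r(\mu_X,\nu_Y)=\big(\inf_{\pi\in\Pi(\mu_X,\nu_Y)}\iint|d_{\mathcal{X}}(x,x')-d_{\mathcal{Y}}(y,y')|^r d\pi(x,y)d\pi(x',y')\big)^{1/r}$. *)

theory Defs
  imports "HOL-Probability.Probability"
begin

text \<open>
  Complete separable metric spaces are types of class \<open>polish_space\<close>; the metric is \<open>dist\<close>.
  A structured object is therefore given by its measure alone, a Borel probability measure on
  the product type of the structure space and the feature space.
\<close>

definition structured_object ::
  "('x::polish_space \<times> 'w::polish_space) measure \<Rightarrow> bool" where
  "structured_object \<mu> \<longleftrightarrow> prob_space \<mu> \<and> sets \<mu> = sets borel"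

definition structure_marginal ::
  "('x::polish_space \<times> 'w::polish_space) measure \<Rightarrow> 'x measure" where
  "structure_marginal \<mu> = distr \<mu> borel fst"

definition feature_marginal ::
  "('x::polish_space \<times> 'w::polish_space) measure \<Rightarrow> 'w measure" where
  "feature_marginal \<mu> = distr \<mu> borel snd"

definition structured_space ::
  "real \<Rightarrow> ('x::polish_space \<times> 'w::polish_space) measure set" where
  "structured_space r = {\<mu>. structured_object \<mu> \<and>
     (\<exists>a0. (\<integral>\<^sup>+ a. ennreal (dist a a0 powr r) \<partial>feature_marginal \<mu>) < \<infinity>) \<and>
     (\<integral>\<^sup>+ x. (\<integral>\<^sup>+ x'. ennreal (dist x x' powr r) \<partial>structure_marginal \<mu>)
        \<partial>structure_marginal \<mu>) < \<infinity>}"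

definition couplings ::
  "'a::topological_space measure \<Rightarrow> 'b::topological_space measure \<Rightarrow> ('a \<times> 'b) measure set" where
  "couplings \<mu> \<nu> = {\<pi>. prob_space \<pi> \<and> sets \<pi> = sets borel \<and>
     distr \<pi> borel fst = \<mu> \<and> distr \<pi> borel snd = \<nu>}"

text \<open>
  Real powers of extended nonnegative reals, meant for positive exponents. The transport costs
  are kept in \<open>ennreal\<close>, so that couplings of infinite cost really count as infinite.
\<close>

definition ennreal_powr :: "ennreal \<Rightarrow> real \<Rightarrow> ennreal" where
  "ennreal_powr t r = (if t = \<infinity> then \<infinity> else ennreal (enn2real t powr r))"

definition FGW ::
  "real \<Rightarrow> real \<Rightarrow> real \<Rightarrow> ('x::polish_space \<times> 'w::polish_space) measure \<Rightarrow>
   ('y::polish_space \<times> 'w) measure \<Rightarrow> ennreal" where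
  "FGW \<alpha> p q \<mu> \<nu> = ennreal_powr
     (INF \<pi>\<in>couplings \<mu> \<nu>.
        \<integral>\<^sup>+ ((x, a), (y, b)). (\<integral>\<^sup>+ ((x', a'), (y', b')).
          ennreal (((1 - \<alpha>) * dist a b powr q + \<alpha> * \<bar>dist x x' - dist y y'\<bar> powr q) powr p)
        \<partial>\<pi>) \<partial>\<pi>)
     (1 / p)"

definition wasserstein ::
  "real \<Rightarrow> 'w::polish_space measure \<Rightarrow> 'w measure \<Rightarrow> ennreal" where
  "wasserstein r \<mu> \<nu> = ennreal_powr
     (INF \<pi>\<in>couplings \<mu> \<nu>. \<integral>\<^sup>+ (a, b). ennreal (dist a b powr r) \<partial>\<pi>) (1 / r)"

definition gromov_wasserstein ::
  "real \<Rightarrow> 'x::polish_space measure \<Rightarrow> 'y::polish_space measure \<Rightarrow> ennreal" where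
  "gromov_wasserstein r \<mu> \<nu> = ennreal_powr
     (INF \<pi>\<in>couplings \<mu> \<nu>.
        \<integral>\<^sup>+ (x, y). (\<integral>\<^sup>+ (x', y'). ennreal (\<bar>dist x x' - dist y y'\<bar> powr r) \<partial>\<pi>) \<partial>\<pi>)
     (1 / r)"

end

theory Submission
  imports Defs
begin

text \<open>
  Write \<open>A \<pi>\<close> and \<open>S \<pi>\<close> for the feature cost and the structure cost (of order \<open>p q\<close>) of a coupling \<open>\<pi>\<close>
  of \<open>\<mu>\<close> and \<open>\<nu>\<close>. By convexity of the \<open>p\<close>-th power, the fused cost of \<open>\<pi>\<close> lies between \<open>(1 - \<alpha>)\<^sup>p A \<pi>\<close>
  and \<open>(1 - \<alpha>) A \<pi> + \<alpha> S \<pi>\<close>, and the moment assumptions bound \<open>A\<close> and \<open>S\<close> uniformly over all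
  couplings; so the infimum of the fused cost tends to \<open>inf A\<close> as \<open>\<alpha>\<close> tends to 0, and symmetrically to
  \<open>inf S\<close> as \<open>\<alpha>\<close> tends to 1.

  It remains to see that \<open>inf A\<close> equals the infimum over couplings of the feature marginals (and likewise
  for \<open>S\<close>). Instead of lifting such a coupling \<open>\<gamma>\<close> exactly, by disintegration, one cuts the marginal spaces
  into countably many cells of diameter at most \<open>e\<close> and couples \<open>\<mu>\<close> and \<open>\<nu>\<close> by a density with respect to
  \<open>\<mu> \<Otimes> \<nu>\<close> that is constant on products of cells and gives each of them its \<open>\<gamma>\<close>-mass. Both costs
  are integrals of powers of Lipschitz functions, so the error vanishes with \<open>e\<close>.
\<close>

section \<open>Integrals over countably many cells, and power inequalities\<close>

lemma nn_integral_countable_valued: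
  fixes j :: "'a \<Rightarrow> 'i::countable"
  assumes [measurable]: "j \<in> M \<rightarrow>\<^sub>M count_space UNIV"
  shows "(\<integral>\<^sup>+x. f (j x) \<partial>M) = (\<integral>\<^sup>+n. f n * emeasure M {x\<in>space M. j x = n} \<partial>count_space UNIV)"
proof -
  have *: "f (j x) = (\<integral>\<^sup>+n. f n * indicator {x\<in>space M. j x = n} x \<partial>count_space UNIV)" if "x \<in> space M" for x
  proof -
    have "(\<integral>\<^sup>+n. f n * indicator {x\<in>space M. j x = n} x \<partial>count_space UNIV)
       = (\<integral>\<^sup>+n. f n * indicator {j x} n \<partial>count_space UNIV)"
      using that by (intro nn_integral_cong) (auto simp: indicator_def)
    then show ?thesis
      by (simp add: nn_integral_indicator_singleton)
  qed
  have "(\<integral>\<^sup>+x. f (j x) \<partial>M) = (\<integral>\<^sup>+x. (\<integral>\<^sup>+n. f n * indicator {x\<in>space M. j x = n} x \<partial>count_space UNIV) \<partial>M)"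
    by (intro nn_integral_cong *)
  also have "\<dots> = (\<integral>\<^sup>+n. (\<integral>\<^sup>+x. f n * indicator {x\<in>space M. j x = n} x \<partial>M) \<partial>count_space UNIV)"
    by (rule nn_integral_count_space_nn_integral) simp_all
  also have "\<dots> = (\<integral>\<^sup>+n. f n * emeasure M {x\<in>space M. j x = n} \<partial>count_space UNIV)"
    by (simp add: nn_integral_cmult)
  finally show ?thesis .
qed

text \<open>Convexity of the power, applied to \<open>u + t\<close> written as
  \<open>(1 - t) * (u / (1 - t)) + t * 1\<close>. It absorbs a perturbation \<open>t\<close> of the
  base at the price of a factor and a summand that tend to 1 and 0 with \<open>t\<close>, uniformly
  in \<open>u\<close>. This makes it suitable for integration. For \<open>u = 0\<close> it reduces
  to \<open>t powr r\<close> \<le> \<open>t\<close>.\<close>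

lemma powr_add_le:
  fixes u t r :: real
  assumes "0 \<le> u" "0 < t" "t < 1" "1 \<le> r"
  shows "(u + t) powr r \<le> (1 - t) powr (1 - r) * u powr r + t"
proof -
  have "((1 - t) * (u / (1 - t)) + t * 1) powr r \<le> (1 - t) * (u / (1 - t)) powr r + t * 1 powr r"
  proof (cases "u = 0")
    case True
    then show ?thesis using assms powr_mono'[of 1 r t] by simp
  next
    case False
    then show ?thesis
      using convex_onD[OF powr_convex[of r], of t "u / (1 - t)" 1] assms by simp
  qed
  also have "(1 - t) * (u / (1 - t)) + t * 1 = u + t" using assms by simp
  also have "(1 - t) * (u / (1 - t)) powr r = (1 - t) powr (1 - r) * u powr r"
    using assms by (simp add: powr_divide powr_diff)
  finally show ?thesis by simp
qed

lemma powr_convex_combination_le: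
  fixes u v t p :: real
  assumes "0 \<le> u" "0 \<le> v" "0 \<le> t" "t \<le> 1" "1 \<le> p"
  shows "((1 - t) * u + t * v) powr p \<le> (1 - t) * u powr p + t * v powr p"
proof -
  \<comment> \<open>When \<open>u\<close> or \<open>v\<close> vanishes, only one weighted power
    remains, and its weight \<open>c\<close> in [0,1] satisfies \<open>c powr p\<close> \<le>
    \<open>c\<close>. Convexity is invoked for positive \<open>u\<close> and
    \<open>v\<close>.\<close>
  have small: "c powr p \<le> c" if "0 \<le> c" "c \<le> 1" for c :: real
    using that assms powr_mono'[of 1 p c] by (cases "c = 0") auto
  consider "u = 0" | "v = 0" | "u > 0" "v > 0" using assms by fastforce
  then show ?thesis
  proof cases
    case 1
    then show ?thesis using assms small[of t] by (simp add: powr_mult mult_right_mono)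
  next
    case 2
    then show ?thesis using assms small[of "1 - t"] by (simp add: powr_mult mult_right_mono)
  next
    case 3
    then show ?thesis
      using convex_onD[OF powr_convex[of p], of t u v] assms by simp
  qed
qed

section \<open>Gluing couplings along countable partitions\<close>

lemma measurable_quantiser:
  fixes e :: real
  assumes "e > 0"
  obtains i :: "'u::{metric_space, second_countable_topology} \<Rightarrow> nat"
  where "i \<in> borel \<rightarrow>\<^sub>M count_space UNIV" "\<And>u u'. i u = i u' \<Longrightarrow> dist u u' \<le> e"
proof -
  obtain D :: "'u set" where D: "countable D" "\<And>X. open X \<Longrightarrow> X \<noteq> {} \<Longrightarrow> \<exists>d\<in>D. d \<in> X"
    by (rule countable_dense_setE) blast
  \<comment> \<open>The index of \<open>u\<close> is the first enumerated point of the dense set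
    within \<open>e / 2\<close>. Taking the least index makes the cells disjoint and measurable, and
    two points of a cell are both within \<open>e / 2\<close> of the same centre.\<close>
  define i where "i u = (LEAST n. dist u (from_nat_into D n) < e / 2)" for u
  have near: "dist u (from_nat_into D (i u)) < e / 2" for u
  proof -
    obtain d where "d \<in> D" "d \<in> ball u (e / 2)"
      using D(2)[of "ball u (e / 2)"] assms by auto
    then show ?thesis
      unfolding i_def
      by (intro LeastI[of "\<lambda>n. dist u (from_nat_into D n) < e / 2" "to_nat_on D d"]) (simp add: D(1))
  qed
  have "i \<in> borel \<rightarrow>\<^sub>M count_space UNIV"
    unfolding i_def by (rule measurable_Least) simp
  moreover have "dist u u' \<le> e" if "i u = i u'" for u u'
    using near[of u] near[of u'] dist_triangle2[of u u' "from_nat_into D (i u)"] that by simp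
  ultimately show thesis by (rule that)
qed

lemma sets_pair_borel:
  fixes M :: "'a::second_countable_topology measure" and N :: "'b::second_countable_topology measure"
  assumes "sets M = sets borel" "sets N = sets borel"
  shows "sets (M \<Otimes>\<^sub>M N) = sets borel"
  using sets_pair_measure_cong[OF assms] by (simp only: borel_prod)

lemma couplingD:
  assumes "\<pi> \<in> couplings M N"
  shows "prob_space \<pi>" "sets \<pi> = sets borel" "distr \<pi> borel fst = M" "distr \<pi> borel snd = N"
  using assms by (auto simp: couplings_def)

lemma sets_coupling_pair:
  fixes M :: "'a::second_countable_topology measure" and N :: "'b::second_countable_topology measure"
  assumes "\<pi> \<in> couplings M N"
  shows "sets \<pi> = sets (borel \<Otimes>\<^sub>M borel)"
  using couplingD(2)[OF assms] by (simp only: borel_prod)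

text \<open>The density with respect to the product measure is constant on each product of cells,
  equal to \<open>c m n\<close> divided by the product mass. For a fixed \<open>s\<close> in a cell
  of positive mass, its integral over \<open>t\<close> is a row sum of \<open>c\<close> divided by
  that mass, hence 1. The first marginal is therefore exactly \<open>M\<close>, also inside the
  cells, and column sums give the second marginal likewise.\<close>

lemma quantised_gluing:
  fixes M :: "'a::second_countable_topology measure" and N :: "'b::second_countable_topology measure"
    and i :: "'a \<Rightarrow> nat" and j :: "'b \<Rightarrow> nat" and c :: "nat \<Rightarrow> nat \<Rightarrow> ennreal"
  assumes M: "prob_space M" "sets M = sets borel" and N: "prob_space N" "sets N = sets borel"
    and i: "i \<in> borel \<rightarrow>\<^sub>M count_space UNIV" and j: "j \<in> borel \<rightarrow>\<^sub>M count_space UNIV"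
    and row: "\<And>m. (\<integral>\<^sup>+n. c m n \<partial>count_space UNIV) = emeasure M {s. i s = m}"
    and col: "\<And>n. (\<integral>\<^sup>+m. c m n \<partial>count_space UNIV) = emeasure N {t. j t = n}"
  obtains \<pi> where "\<pi> \<in> couplings M N" "\<And>m n. emeasure \<pi> {z. i (fst z) = m \<and> j (snd z) = n} = c m n"
proof -
  interpret M: prob_space M by fact
  interpret N: prob_space N by fact
  interpret MN: pair_prob_space M N ..
  note [measurable_cong] = M(2) N(2)
  note [measurable] = i j
  have sp: "space M = UNIV" "space N = UNIV"
    using M(2) N(2) by (auto dest: sets_eq_imp_space_eq)
  define a b where "a m = emeasure M {s. i s = m}" and "b n = emeasure N {t. j t = n}" for m n
  have fin: "a m \<noteq> \<infinity>" "b n \<noteq> \<infinity>" for m n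
    by (simp_all add: a_def b_def)
  have c_le: "c m n \<le> a m" "c m n \<le> b n" for m n
    using nn_integral_ge_point[of n UNIV] nn_integral_ge_point[of m UNIV "\<lambda>m. c m n"]
    unfolding a_def b_def row[symmetric] col[symmetric] by simp_all
  \<comment> \<open>If \<open>a m = 0\<close> or \<open>b n = 0\<close>, then \<open>c m n = 0\<close> and the quotient is \<open>0\<close>, since \<open>0 * \<infinity> = 0\<close>.\<close>
  define w where "w m n = c m n / (a m * b n)" for m n
  have w_ab: "w m n * b n = c m n / a m" "w m n * a m = c m n / b n" for m n
  proof -
    obtain x y z where xyz: "a m = ennreal x" "b n = ennreal y" "c m n = ennreal z" "0 \<le> x" "0 \<le> y" "0 \<le> z"
      using fin(1)[of m] fin(2)[of n] c_le(1)[of m n] by (cases "a m"; cases "b n"; cases "c m n") (auto simp: top_unique)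
    show "w m n * b n = c m n / a m" "w m n * a m = c m n / b n"
      using xyz c_le[of m n]
      by (cases "x = 0"; cases "y = 0"; simp add: w_def divide_ennreal ennreal_mult[symmetric])+
  qed
  define \<pi> where "\<pi> = density (M \<Otimes>\<^sub>M N) (\<lambda>z. w (i (fst z)) (j (snd z)))"
  have [measurable_cong]: "sets \<pi> = sets (M \<Otimes>\<^sub>M N)" by (simp add: \<pi>_def)
  have sets: "sets \<pi> = sets borel"
    using sets_pair_borel[OF M(2) N(2)] by (simp add: \<pi>_def)
  have int_t: "(\<integral>\<^sup>+t. w m (j t) \<partial>N) = 1" if "a m \<noteq> 0" for m
  proof -
    have "(\<integral>\<^sup>+t. w m (j t) \<partial>N) = (\<integral>\<^sup>+n. w m n * b n \<partial>count_space UNIV)"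
      by (subst nn_integral_countable_valued) (simp_all add: sp b_def)
    also have "\<dots> = a m / a m"
      by (simp add: w_ab nn_integral_divide row a_def)
    finally show ?thesis using that fin(1)[of m] by (simp add: less_top)
  qed
  have int_s: "(\<integral>\<^sup>+s. w (i s) n \<partial>M) = 1" if "b n \<noteq> 0" for n
  proof -
    have "(\<integral>\<^sup>+s. w (i s) n \<partial>M) = (\<integral>\<^sup>+m. w m n * a m \<partial>count_space UNIV)"
      by (subst nn_integral_countable_valued[where f = "\<lambda>m. w m n"]) (simp_all add: sp a_def)
    also have "\<dots> = b n / b n"
      by (simp add: w_ab nn_integral_divide col b_def)
    finally show ?thesis using that fin(2)[of n] by (simp add: less_top)
  qed
  \<comment> \<open>On a cell of mass 0 the density integrates to 0 over the fibre instead of 1.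
    There are countably many such cells, so together they form a null set.\<close>
  have ae_s: "AE s in M. a (i s) \<noteq> 0"
  proof -
    have "(\<integral>\<^sup>+s. (if a (i s) = 0 then 1 else 0) \<partial>M) = 0"
      by (subst nn_integral_countable_valued[where f = "\<lambda>n. if a n = 0 then 1 else 0"])
        (simp_all add: sp nn_integral_0_iff_AE AE_count_space flip: a_def)
    then show ?thesis by (subst (asm) nn_integral_0_iff_AE) (auto split: if_splits)
  qed
  have ae_t: "AE t in N. b (j t) \<noteq> 0"
  proof -
    have "(\<integral>\<^sup>+t. (if b (j t) = 0 then 1 else 0) \<partial>N) = 0"
      by (subst nn_integral_countable_valued[where f = "\<lambda>n. if b n = 0 then 1 else 0"])
        (simp_all add: sp nn_integral_0_iff_AE AE_count_space flip: b_def)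
    then show ?thesis by (subst (asm) nn_integral_0_iff_AE) (auto split: if_splits)
  qed
  have distr_fst: "distr \<pi> borel fst = M"
  proof (rule measure_eqI)
    fix E assume "E \<in> sets (distr \<pi> borel fst)"
    then have [measurable]: "E \<in> sets borel" by simp
    have "emeasure (distr \<pi> borel fst) E = (\<integral>\<^sup>+x. indicator E x \<partial>distr \<pi> borel fst)"
      by simp
    also have "\<dots> = (\<integral>\<^sup>+z. indicator E (fst z) \<partial>\<pi>)"
      by (rule nn_integral_distr) measurable
    also have "\<dots> = (\<integral>\<^sup>+z. w (i (fst z)) (j (snd z)) * indicator E (fst z) \<partial>(M \<Otimes>\<^sub>M N))"
      unfolding \<pi>_def by (rule nn_integral_density) measurable
    also have "\<dots> = (\<integral>\<^sup>+s. (\<integral>\<^sup>+t. w (i s) (j t) \<partial>N) * indicator E s \<partial>M)"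
      by (subst N.nn_integral_fst[symmetric]) (auto simp: nn_integral_multc)
    also have "\<dots> = (\<integral>\<^sup>+s. indicator E s \<partial>M)"
      by (intro nn_integral_cong_AE) (use ae_s in \<open>eventually_elim, simp add: int_t\<close>)
    finally show "emeasure (distr \<pi> borel fst) E = emeasure M E" by (simp add: M(2))
  qed (simp add: M(2))
  have distr_snd: "distr \<pi> borel snd = N"
  proof (rule measure_eqI)
    fix E assume "E \<in> sets (distr \<pi> borel snd)"
    then have [measurable]: "E \<in> sets borel" by simp
    have "emeasure (distr \<pi> borel snd) E = (\<integral>\<^sup>+x. indicator E x \<partial>distr \<pi> borel snd)"
      by simp
    also have "\<dots> = (\<integral>\<^sup>+z. indicator E (snd z) \<partial>\<pi>)"
      by (rule nn_integral_distr) measurable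
    also have "\<dots> = (\<integral>\<^sup>+z. w (i (fst z)) (j (snd z)) * indicator E (snd z) \<partial>(M \<Otimes>\<^sub>M N))"
      unfolding \<pi>_def by (rule nn_integral_density) measurable
    also have "\<dots> = (\<integral>\<^sup>+t. (\<integral>\<^sup>+s. w (i s) (j t) \<partial>M) * indicator E t \<partial>N)"
      by (subst MN.nn_integral_snd[symmetric]) (auto simp: nn_integral_multc)
    also have "\<dots> = (\<integral>\<^sup>+t. indicator E t \<partial>N)"
      by (intro nn_integral_cong_AE) (use ae_t in \<open>eventually_elim, simp add: int_s\<close>)
    finally show "emeasure (distr \<pi> borel snd) E = emeasure N E" by (simp add: N(2))
  qed (simp add: N(2))
  \<comment> \<open>The total mass of \<pi> is that of its first marginal.\<close>
  have "prob_space (distr \<pi> borel fst)" by (simp add: distr_fst M(1))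
  then have "prob_space \<pi>" by (rule prob_space_distrD[rotated]) measurable
  then have "\<pi> \<in> couplings M N"
    using sets distr_fst distr_snd by (simp add: couplings_def)
  moreover have "emeasure \<pi> {z. i (fst z) = m \<and> j (snd z) = n} = c m n" for m n
  proof -
    have "{z. i (fst z) = m \<and> j (snd z) = n} = {s. i s = m} \<times> {t. j t = n}" by auto
    moreover have "emeasure \<pi> ({s. i s = m} \<times> {t. j t = n})
        = (\<integral>\<^sup>+z. w m n * indicator ({s. i s = m} \<times> {t. j t = n}) z \<partial>(M \<Otimes>\<^sub>M N))"
      unfolding \<pi>_def
      by (subst emeasure_density) (auto simp: indicator_def intro!: nn_integral_cong)
    ultimately have "emeasure \<pi> {z. i (fst z) = m \<and> j (snd z) = n}
        = (\<integral>\<^sup>+z. w m n * indicator ({s. i s = m} \<times> {t. j t = n}) z \<partial>(M \<Otimes>\<^sub>M N))" by simp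
    also have "\<dots> = w m n * (a m * b n)"
      by (subst nn_integral_cmult_indicator) (simp_all add: N.emeasure_pair_measure_Times a_def b_def)
    also have "\<dots> = c m n"
    proof (cases "a m = 0 \<or> b n = 0")
      case True
      then show ?thesis using c_le[of m n] by auto
    next
      case False
      then show ?thesis
        using fin(1)[of m] fin(2)[of n]
        by (simp add: w_def ennreal_divide_times ennreal_mult_less_top less_top)
    qed
    finally show ?thesis .
  qed
  ultimately show thesis by (rule that)
qed

text \<open>The coupling \<pi> gives each product of cells the mass that \<gamma> gives it, so two
  independent draws from \<pi> and two from \<gamma> have cell indices with the same law. Points
  with equal indices are within \<open>e\<close> of each other, so the pointwise comparison of
  \<open>h\<close> with \<open>k\<close> at such points passes to the double integrals. Costs over
  two draws are needed because the structure cost compares pairs of points.\<close>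

lemma approximate_gluing:
  fixes M :: "'a::second_countable_topology measure" and N :: "'b::second_countable_topology measure"
    and f :: "'a \<Rightarrow> 'u::{metric_space, second_countable_topology}"
    and g :: "'b \<Rightarrow> 'v::{metric_space, second_countable_topology}"
    and e :: real
  assumes M: "prob_space M" "sets M = sets borel" and N: "prob_space N" "sets N = sets borel"
    and f[measurable]: "f \<in> borel \<rightarrow>\<^sub>M borel" and g[measurable]: "g \<in> borel \<rightarrow>\<^sub>M borel"
    and \<gamma>: "\<gamma> \<in> couplings (distr M borel f) (distr N borel g)" and "e > 0"
  shows "\<exists>\<pi>\<in>couplings M N. \<forall>h k.
      (\<forall>s t s' t' u v u' v'. dist (f s) u \<le> e \<longrightarrow> dist (g t) v \<le> e \<longrightarrow>
        dist (f s') u' \<le> e \<longrightarrow> dist (g t') v' \<le> e \<longrightarrow> h (s, t) (s', t') \<le> k (u, v) (u', v')) \<longrightarrow>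
      (\<integral>\<^sup>+z. (\<integral>\<^sup>+z'. h z z' \<partial>\<pi>) \<partial>\<pi>) \<le> (\<integral>\<^sup>+w. (\<integral>\<^sup>+w'. k w w' \<partial>\<gamma>) \<partial>\<gamma>)"
proof -
  obtain i :: "'u \<Rightarrow> nat" where i[measurable]: "i \<in> borel \<rightarrow>\<^sub>M count_space UNIV"
    and i_close: "\<And>u u'. i u = i u' \<Longrightarrow> dist u u' \<le> e"
    using measurable_quantiser[OF \<open>e > 0\<close>] by blast
  obtain j :: "'v \<Rightarrow> nat" where j[measurable]: "j \<in> borel \<rightarrow>\<^sub>M count_space UNIV"
    and j_close: "\<And>v v'. j v = j v' \<Longrightarrow> dist v v' \<le> e"
    using measurable_quantiser[OF \<open>e > 0\<close>] by blast
  note \<gamma>D = couplingD[OF \<gamma>]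
  note [measurable_cong] = sets_coupling_pair[OF \<gamma>] M(2) N(2)
  have sp: "space M = UNIV" "space N = UNIV" "space \<gamma> = UNIV"
    using M(2) N(2) \<gamma>D(2) by (auto dest: sets_eq_imp_space_eq)
  have cell: "{w. i (fst w) = m \<and> j (snd w) = n} \<in> sets \<gamma>" for m n
  proof -
    have "{w \<in> space \<gamma>. i (fst w) = m \<and> j (snd w) = n} \<in> sets \<gamma>" by measurable
    then show ?thesis by (simp add: sp)
  qed
  \<comment> \<open>These masses are admissible for \<open>quantised_gluing\<close>: summing over
    one index gives a marginal of \<gamma> on a cell, which is the image of \<open>M\<close> or
    \<open>N\<close>.\<close>
  define c where "c m n = emeasure \<gamma> {w. i (fst w) = m \<and> j (snd w) = n}" for m n
  have row: "(\<integral>\<^sup>+n. c m n \<partial>count_space UNIV) = emeasure M {s. (i \<circ> f) s = m}" for m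
  proof -
    have "(\<integral>\<^sup>+n. c m n \<partial>count_space UNIV) = emeasure \<gamma> (\<Union>n. {w. i (fst w) = m \<and> j (snd w) = n})"
      unfolding c_def by (subst emeasure_UN_countable) (auto simp: cell disjoint_family_on_def)
    also have "(\<Union>n. {w. i (fst w) = m \<and> j (snd w) = n}) = fst -` {u. i u = m} \<inter> space \<gamma>"
      by (auto simp: sp)
    also have "emeasure \<gamma> \<dots> = emeasure (distr \<gamma> borel fst) {u. i u = m}"
      by (rule emeasure_distr[symmetric]) measurable
    also have "\<dots> = emeasure M (f -` {u. i u = m} \<inter> space M)"
      unfolding \<gamma>D(3) by (rule emeasure_distr) measurable
    finally show ?thesis by (simp add: sp vimage_def)
  qed
  have col: "(\<integral>\<^sup>+m. c m n \<partial>count_space UNIV) = emeasure N {t. (j \<circ> g) t = n}" for n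
  proof -
    have "(\<integral>\<^sup>+m. c m n \<partial>count_space UNIV) = emeasure \<gamma> (\<Union>m. {w. i (fst w) = m \<and> j (snd w) = n})"
      unfolding c_def by (subst emeasure_UN_countable) (auto simp: cell disjoint_family_on_def)
    also have "(\<Union>m. {w. i (fst w) = m \<and> j (snd w) = n}) = snd -` {v. j v = n} \<inter> space \<gamma>"
      by (auto simp: sp)
    also have "emeasure \<gamma> \<dots> = emeasure (distr \<gamma> borel snd) {v. j v = n}"
      by (rule emeasure_distr[symmetric]) measurable
    also have "\<dots> = emeasure N (g -` {v. j v = n} \<inter> space N)"
      unfolding \<gamma>D(4) by (rule emeasure_distr) measurable
    finally show ?thesis by (simp add: sp vimage_def)
  qed
  obtain \<pi> where \<pi>: "\<pi> \<in> couplings M N"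
    and cells: "\<And>m n. emeasure \<pi> {z. (i \<circ> f) (fst z) = m \<and> (j \<circ> g) (snd z) = n} = c m n"
    by (rule quantised_gluing[OF M N _ _ row col]) auto
  note [measurable_cong] = sets_coupling_pair[OF \<pi>]
  have sp\<pi>: "space \<pi> = UNIV"
    using couplingD(2)[OF \<pi>] by (auto dest: sets_eq_imp_space_eq)
  define I where "I z = (i (f (fst z)), j (g (snd z)))" for z
  define J where "J w = (i (fst w), j (snd w))" for w
  have [measurable]: "I \<in> \<pi> \<rightarrow>\<^sub>M count_space UNIV" "J \<in> \<gamma> \<rightarrow>\<^sub>M count_space UNIV"
    unfolding I_def J_def by measurable
  \<comment> \<open>Laws on a countable type are determined by singletons. After this, any function
    of two index pairs has the same double integral under \<pi> and \<gamma>.\<close>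
  have Q: "distr \<pi> (count_space UNIV) I = distr \<gamma> (count_space UNIV) J"
  proof (rule measure_eqI_countable[of _ UNIV])
    fix x :: "nat \<times> nat"
    obtain m n where x: "x = (m, n)" by force
    have "I -` {x} \<inter> space \<pi> = {z. (i \<circ> f) (fst z) = m \<and> (j \<circ> g) (snd z) = n}"
      "J -` {x} \<inter> space \<gamma> = {w. i (fst w) = m \<and> j (snd w) = n}"
      by (auto simp: I_def J_def x sp sp\<pi>)
    then show "emeasure (distr \<pi> (count_space UNIV) I) {x} = emeasure (distr \<gamma> (count_space UNIV) J) {x}"
      using cells by (simp add: emeasure_distr c_def)
  qed simp_all
  show ?thesis
  proof (intro bexI[OF _ \<pi>] allI impI)
    fix h :: "'a \<times> 'b \<Rightarrow> 'a \<times> 'b \<Rightarrow> ennreal" and k :: "'u \<times> 'v \<Rightarrow> 'u \<times> 'v \<Rightarrow> ennreal"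
    assume hk: "\<forall>s t s' t' u v u' v'. dist (f s) u \<le> e \<longrightarrow> dist (g t) v \<le> e \<longrightarrow>
        dist (f s') u' \<le> e \<longrightarrow> dist (g t') v' \<le> e \<longrightarrow> h (s, t) (s', t') \<le> k (u, v) (u', v')"
    \<comment> \<open>Passing to suprema over cells makes the cost a function on a countable type, where
      measurability of \<open>h\<close> and \<open>k\<close> is irrelevant.\<close>
    define H where "H x x' = (SUP zz\<in>{(z, z'). I z = x \<and> I z' = x'}. h (fst zz) (snd zz))" for x x'
    have h_le: "h z z' \<le> H (I z) (I z')" for z z'
      unfolding H_def by (rule SUP_upper2[of "(z, z')"]) auto
    \<comment> \<open>Every pair that enters the supremum has the indices of \<open>w\<close> and
      \<open>w'\<close>, so its projections share cells with them and lie within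
      \<open>e\<close>.\<close>
    have H_le: "H (J w) (J w') \<le> k w w'" for w w'
      unfolding H_def
    proof (rule SUP_least, clarsimp)
      fix s t s' t' assume "I (s, t) = J w" "I (s', t') = J w'"
      then show "h (s, t) (s', t') \<le> k w w'"
        using hk[rule_format, of s "fst w" t "snd w" s' "fst w'" t' "snd w'"] i_close j_close
        by (simp add: I_def J_def)
    qed
    have "(\<integral>\<^sup>+z. (\<integral>\<^sup>+z'. h z z' \<partial>\<pi>) \<partial>\<pi>) \<le> (\<integral>\<^sup>+z. (\<integral>\<^sup>+z'. H (I z) (I z') \<partial>\<pi>) \<partial>\<pi>)"
      by (intro nn_integral_mono h_le)
    also have "\<dots> = (\<integral>\<^sup>+x. (\<integral>\<^sup>+x'. H x x' \<partial>distr \<pi> (count_space UNIV) I) \<partial>distr \<pi> (count_space UNIV) I)"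
      by (simp add: nn_integral_distr)
    also have "\<dots> = (\<integral>\<^sup>+w. (\<integral>\<^sup>+w'. H (J w) (J w') \<partial>\<gamma>) \<partial>\<gamma>)"
      unfolding Q by (simp add: nn_integral_distr)
    also have "\<dots> \<le> (\<integral>\<^sup>+w. (\<integral>\<^sup>+w'. k w w' \<partial>\<gamma>) \<partial>\<gamma>)"
      by (intro nn_integral_mono H_le)
    finally show "(\<integral>\<^sup>+z. (\<integral>\<^sup>+z'. h z z' \<partial>\<pi>) \<partial>\<pi>) \<le> (\<integral>\<^sup>+w. (\<integral>\<^sup>+w'. k w w' \<partial>\<gamma>) \<partial>\<gamma>)" .
  qed
qed

section \<open>Infima over couplings and over their projections\<close>

lemma coupling_distr:
  fixes M :: "'a::second_countable_topology measure" and N :: "'b::second_countable_topology measure"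
    and f :: "'a \<Rightarrow> 'u::second_countable_topology" and g :: "'b \<Rightarrow> 'v::second_countable_topology"
  assumes \<pi>: "\<pi> \<in> couplings M N"
    and [measurable]: "f \<in> borel \<rightarrow>\<^sub>M borel" "g \<in> borel \<rightarrow>\<^sub>M borel"
  shows "distr \<pi> (borel \<Otimes>\<^sub>M borel) (\<lambda>z. (f (fst z), g (snd z))) \<in> couplings (distr M borel f) (distr N borel g)"
proof -
  note [measurable_cong] = sets_coupling_pair[OF \<pi>]
  interpret prob_space \<pi> by (rule couplingD[OF \<pi>])
  have "prob_space (distr \<pi> (borel \<Otimes>\<^sub>M borel) (\<lambda>z. (f (fst z), g (snd z))))"
    by (rule prob_space_distr) measurable
  moreover have "distr (distr \<pi> (borel \<Otimes>\<^sub>M borel) (\<lambda>z. (f (fst z), g (snd z)))) borel fst = distr (distr \<pi> borel fst) borel f"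
    by (simp add: distr_distr comp_def)
  moreover have "distr (distr \<pi> (borel \<Otimes>\<^sub>M borel) (\<lambda>z. (f (fst z), g (snd z)))) borel snd = distr (distr \<pi> borel snd) borel g"
    by (simp add: distr_distr comp_def)
  ultimately show ?thesis
    using couplingD(3,4)[OF \<pi>] by (simp add: couplings_def) (simp only: borel_prod)
qed

lemma (in prob_space) nn_integral_affine:
  assumes [measurable]: "G \<in> borel_measurable M"
  shows "(\<integral>\<^sup>+w. c * G w + d \<partial>M) = c * (\<integral>\<^sup>+w. G w \<partial>M) + d"
  by (simp add: nn_integral_add nn_integral_cmult emeasure_space_1)

text \<open>Pushing a coupling forward preserves its cost, which gives one inequality. For the
  other, a coupling of the images is lifted approximately; the Lipschitz bound on \<open>k\<close>
  controls the error, which then tends to 0. A kernel of two points covers both costs, since the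
  feature cost is the case in which \<open>k\<close> ignores its second argument.\<close>

lemma INF_couplings_projection:
  fixes M :: "'a::second_countable_topology measure" and N :: "'b::second_countable_topology measure"
    and f :: "'a \<Rightarrow> 'u::{metric_space, second_countable_topology}"
    and g :: "'b \<Rightarrow> 'v::{metric_space, second_countable_topology}"
    and k :: "'u \<times> 'v \<Rightarrow> 'u \<times> 'v \<Rightarrow> real" and r :: real
  assumes M: "prob_space M" "sets M = sets borel" and N: "prob_space N" "sets N = sets borel"
    and f[measurable]: "f \<in> borel \<rightarrow>\<^sub>M borel" and g[measurable]: "g \<in> borel \<rightarrow>\<^sub>M borel"
    and k[measurable]: "case_prod k \<in> borel_measurable ((borel \<Otimes>\<^sub>M borel) \<Otimes>\<^sub>M (borel \<Otimes>\<^sub>M borel))"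
    and k_nonneg: "\<And>w w'. 0 \<le> k w w'"
    and k_lipschitz: "\<And>u v u' v' x y x' y'.
      k (u, v) (u', v') \<le> k (x, y) (x', y') + (dist u x + dist v y + dist u' x' + dist v' y')"
    and r: "1 \<le> r"
  shows "(INF \<pi>\<in>couplings M N. \<integral>\<^sup>+z. (\<integral>\<^sup>+z'. ennreal (k (f (fst z), g (snd z)) (f (fst z'), g (snd z')) powr r) \<partial>\<pi>) \<partial>\<pi>)
    = (INF \<gamma>\<in>couplings (distr M borel f) (distr N borel g). \<integral>\<^sup>+w. (\<integral>\<^sup>+w'. ennreal (k w w' powr r) \<partial>\<gamma>) \<partial>\<gamma>)"
    (is "?L = ?R")
proof (rule antisym)
  show "?R \<le> ?L"
  proof (rule INF_greatest)
    fix \<pi> assume \<pi>: "\<pi> \<in> couplings M N"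
    note [measurable_cong] = sets_coupling_pair[OF \<pi>]
    interpret prob_space \<pi> by (rule couplingD[OF \<pi>])
    define \<gamma> where "\<gamma> = distr \<pi> (borel \<Otimes>\<^sub>M borel) (\<lambda>z. (f (fst z), g (snd z)))"
    interpret \<gamma>: prob_space \<gamma> unfolding \<gamma>_def by (rule prob_space_distr) measurable
    have [measurable_cong]: "sets \<gamma> = sets (borel \<Otimes>\<^sub>M borel)" by (simp add: \<gamma>_def)
    have push: "(\<integral>\<^sup>+w. G w \<partial>\<gamma>) = (\<integral>\<^sup>+z. G (f (fst z), g (snd z)) \<partial>\<pi>)"
      if [measurable]: "G \<in> borel_measurable (borel \<Otimes>\<^sub>M borel)" for G
      unfolding \<gamma>_def by (rule nn_integral_distr) measurable
    have "?R \<le> (\<integral>\<^sup>+w. (\<integral>\<^sup>+w'. ennreal (k w w' powr r) \<partial>\<gamma>) \<partial>\<gamma>)"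
      using coupling_distr[OF \<pi> f g] by (intro INF_lower) (simp add: \<gamma>_def)
    also have "\<dots> = (\<integral>\<^sup>+z. (\<integral>\<^sup>+w'. ennreal (k (f (fst z), g (snd z)) w' powr r) \<partial>\<gamma>) \<partial>\<pi>)"
      by (rule push) measurable
    also have "\<dots> = (\<integral>\<^sup>+z. (\<integral>\<^sup>+z'. ennreal (k (f (fst z), g (snd z)) (f (fst z'), g (snd z')) powr r) \<partial>\<pi>) \<partial>\<pi>)"
      by (intro nn_integral_cong push) measurable
    finally show "?R \<le> \<dots>" .
  qed
  show "?L \<le> ?R"
  proof (rule INF_greatest)
    fix \<gamma> assume \<gamma>: "\<gamma> \<in> couplings (distr M borel f) (distr N borel g)"
    note [measurable_cong] = sets_coupling_pair[OF \<gamma>]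
    interpret prob_space \<gamma> by (rule couplingD[OF \<gamma>])
    have k_inner: "(\<lambda>w'. ennreal (k w w' powr r)) \<in> borel_measurable \<gamma>" for w
      using measurable_Pair2[OF k, of w] by (simp add: space_pair_measure)
    have k_outer: "(\<lambda>w. \<integral>\<^sup>+w'. ennreal (k w w' powr r) \<partial>\<gamma>) \<in> borel_measurable \<gamma>"
      by measurable
    define J where "J = (\<integral>\<^sup>+w. (\<integral>\<^sup>+w'. ennreal (k w w' powr r) \<partial>\<gamma>) \<partial>\<gamma>)"
    have approx: "?L \<le> ennreal ((1 - t) powr (1 - r)) * J + ennreal t" if t: "0 < t" "t < 1" for t :: real
    proof -
      \<comment> \<open>The Lipschitz bound adds up four displacements, so cells of diameter at most
        \<open>t / 4\<close> change \<open>k\<close> by at most \<open>t\<close>. Below,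
        \<open>t'\<close> and \<open>t''\<close> are points of the space of \<open>N\<close>,
        unrelated to the error \<open>t\<close>.\<close>
      have "0 < t / 4" using t by simp
      from approximate_gluing[OF M N f g \<gamma> this] obtain \<pi> where \<pi>: "\<pi> \<in> couplings M N" and le:
        "\<forall>h k. (\<forall>s t' s' t'' u v u' v'. dist (f s) u \<le> t / 4 \<longrightarrow> dist (g t') v \<le> t / 4 \<longrightarrow>
          dist (f s') u' \<le> t / 4 \<longrightarrow> dist (g t'') v' \<le> t / 4 \<longrightarrow> h (s, t') (s', t'') \<le> k (u, v) (u', v')) \<longrightarrow>
          (\<integral>\<^sup>+z. (\<integral>\<^sup>+z'. h z z' \<partial>\<pi>) \<partial>\<pi>) \<le> (\<integral>\<^sup>+w. (\<integral>\<^sup>+w'. k w w' \<partial>\<gamma>) \<partial>\<gamma>)" ..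
      have "?L \<le> (\<integral>\<^sup>+z. (\<integral>\<^sup>+z'. ennreal (k (f (fst z), g (snd z)) (f (fst z'), g (snd z')) powr r) \<partial>\<pi>) \<partial>\<pi>)"
        by (rule INF_lower[OF \<pi>])
      also have "\<dots> \<le> (\<integral>\<^sup>+w. (\<integral>\<^sup>+w'. ennreal ((1 - t) powr (1 - r)) * ennreal (k w w' powr r) + ennreal t \<partial>\<gamma>) \<partial>\<gamma>)"
      proof (rule le[THEN spec[of _ "\<lambda>z z'. ennreal (k (f (fst z), g (snd z)) (f (fst z'), g (snd z')) powr r)"],
            THEN spec[of _ "\<lambda>w w'. ennreal ((1 - t) powr (1 - r)) * ennreal (k w w' powr r) + ennreal t"], THEN mp],
          intro allI impI)
        fix s t' s' t'' u v u' v'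
        assume d: "dist (f s) u \<le> t / 4" "dist (g t') v \<le> t / 4" "dist (f s') u' \<le> t / 4" "dist (g t'') v' \<le> t / 4"
        have "k (f s, g t') (f s', g t'') powr r \<le> (k (u, v) (u', v') + t) powr r"
          using k_lipschitz[of "f s" "g t'" "f s'" "g t''" u v u' v'] d r
          by (intro powr_mono2) (auto simp: k_nonneg)
        also have "\<dots> \<le> (1 - t) powr (1 - r) * k (u, v) (u', v') powr r + t"
          by (rule powr_add_le) (use k_nonneg t r in auto)
        finally have "ennreal (k (f s, g t') (f s', g t'') powr r) \<le> ennreal ((1 - t) powr (1 - r) * k (u, v) (u', v') powr r + t)"
          by (rule ennreal_leI)
        then show "ennreal (k (f (fst (s, t')), g (snd (s, t'))) (f (fst (s', t'')), g (snd (s', t''))) powr r)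
            \<le> ennreal ((1 - t) powr (1 - r)) * ennreal (k (u, v) (u', v') powr r) + ennreal t"
          using t by (simp add: ennreal_mult)
      qed
      also have "\<dots> = ennreal ((1 - t) powr (1 - r)) * J + ennreal t"
        by (simp add: J_def k_inner k_outer nn_integral_affine)
      finally show ?thesis .
    qed
    show "?L \<le> (\<integral>\<^sup>+w. (\<integral>\<^sup>+w'. ennreal (k w w' powr r) \<partial>\<gamma>) \<partial>\<gamma>)"
    \<comment> \<open>For finite \<open>J\<close> the bound \<open>approx\<close> tends to
      \<open>J\<close> as \<open>t\<close> decreases to 0; for infinite \<open>J\<close> there is
      nothing to prove.\<close>
    proof (cases J)
      case (real x)
      have "((\<lambda>t. ennreal ((1 - t) powr (1 - r) * x + t)) \<longlongrightarrow> ennreal ((1 - 0) powr (1 - r) * x + 0)) (at_right 0)"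
        by (intro tendsto_ennrealI tendsto_intros) auto
      moreover have "\<forall>\<^sub>F t in at_right 0. ?L \<le> ennreal ((1 - t) powr (1 - r) * x + t)"
        using eventually_at_right_real[of 0 "1::real"] approx real
        by (auto elim!: eventually_mono simp: ennreal_mult ennreal_plus)
      ultimately have "?L \<le> ennreal ((1 - 0) powr (1 - r) * x + 0)"
        by (intro tendsto_lowerbound) auto
      then show ?thesis using real by (simp add: J_def)
    qed (simp add: J_def)
  qed
qed

section \<open>Existence of couplings, and limits of interpolated costs\<close>

text \<open>Gluing with a single cell of mass 1 on each side yields the product coupling.\<close>

lemma couplings_nonempty:
  fixes M :: "'a::second_countable_topology measure" and N :: "'b::second_countable_topology measure"
  assumes M: "prob_space M" "sets M = sets borel" and N: "prob_space N" "sets N = sets borel"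
  shows "couplings M N \<noteq> {}"
proof -
  have sp: "space M = UNIV" "space N = UNIV"
    using M(2) N(2) by (auto dest: sets_eq_imp_space_eq)
  have one: "emeasure M UNIV = 1" "emeasure N UNIV = 1"
    using prob_space.emeasure_space_1[OF M(1)] prob_space.emeasure_space_1[OF N(1)] by (simp_all add: sp)
  have ind: "(\<integral>\<^sup>+n. (if n = (0::nat) then 1 else 0) \<partial>count_space UNIV) = (1::ennreal)"
    using nn_integral_indicator[of "{0::nat}" "count_space UNIV"] by (simp add: indicator_def of_bool_def)
  show ?thesis
    by (rule quantised_gluing[OF M N, of "\<lambda>_. 0" "\<lambda>_. 0" "\<lambda>m n. of_bool (m = 0) * of_bool (n = 0)"])
       (auto simp: nn_integral_cmult nn_integral_multc ind one of_bool_def)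
qed

text \<open>The infimum is squeezed: dropping the \<open>Y\<close> term bounds it below by
  \<open>(1 - \<alpha>) powr p\<close> times the limit, and convexity bounds it above by a
  combination of the \<open>X\<close> cost of any single coupling and \<open>B\<close>. With
  \<open>X\<close> and \<open>Y\<close> abstract, exchanging them handles the other
  endpoint.\<close>

lemma tendsto_interpolated_INF:
  fixes C :: "'z::topological_space measure set" and X Y :: "'z \<Rightarrow> 'z \<Rightarrow> real" and p :: real and B :: ennreal
  assumes p: "1 \<le> p" and "\<And>z z'. 0 \<le> X z z'" "\<And>z z'. 0 \<le> Y z z'"
    and prob: "\<And>\<pi>. \<pi> \<in> C \<Longrightarrow> prob_space \<pi>"
    and sets: "\<And>\<pi>. \<pi> \<in> C \<Longrightarrow> sets \<pi> = sets borel"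
    and [measurable]: "case_prod X \<in> borel_measurable (borel \<Otimes>\<^sub>M borel)"
      "case_prod Y \<in> borel_measurable (borel \<Otimes>\<^sub>M borel)"
    and B: "B < \<infinity>" "\<And>\<pi>. \<pi> \<in> C \<Longrightarrow> (\<integral>\<^sup>+z. (\<integral>\<^sup>+z'. ennreal (Y z z' powr p) \<partial>\<pi>) \<partial>\<pi>) \<le> B"
    and J: "(INF \<pi>\<in>C. \<integral>\<^sup>+z. (\<integral>\<^sup>+z'. ennreal (X z z' powr p) \<partial>\<pi>) \<partial>\<pi>) < \<infinity>"
  shows "((\<lambda>\<alpha>. INF \<pi>\<in>C. \<integral>\<^sup>+z. (\<integral>\<^sup>+z'. ennreal (((1 - \<alpha>) * X z z' + \<alpha> * Y z z') powr p) \<partial>\<pi>) \<partial>\<pi>)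
    \<longlongrightarrow> (INF \<pi>\<in>C. \<integral>\<^sup>+z. (\<integral>\<^sup>+z'. ennreal (X z z' powr p) \<partial>\<pi>) \<partial>\<pi>)) (at 0 within {0..1})"
    (is "(?I \<longlongrightarrow> ?J) _")
proof (rule order_tendstoI)
  define A where "A \<pi> = (\<integral>\<^sup>+z. (\<integral>\<^sup>+z'. ennreal (X z z' powr p) \<partial>\<pi>) \<partial>\<pi>)" for \<pi>
  have ev: "\<forall>\<^sub>F \<alpha> in at 0 within {0..1}. 0 \<le> \<alpha> \<and> \<alpha> \<le> (1::real)"
    by (auto simp: eventually_at_filter)
  have upper: "?I \<alpha> \<le> ennreal (1 - \<alpha>) * A \<pi> + ennreal \<alpha> * B" if \<pi>: "\<pi> \<in> C" and \<alpha>: "0 \<le> \<alpha> \<and> \<alpha> \<le> 1" for \<pi> \<alpha>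
  proof -
    interpret prob_space \<pi> by (rule prob[OF \<pi>])
    note [measurable_cong] = sets[OF \<pi>]
    have "?I \<alpha> \<le> (\<integral>\<^sup>+z. (\<integral>\<^sup>+z'. ennreal (((1 - \<alpha>) * X z z' + \<alpha> * Y z z') powr p) \<partial>\<pi>) \<partial>\<pi>)"
      by (rule INF_lower[OF \<pi>])
    also have "\<dots> \<le> (\<integral>\<^sup>+z. (\<integral>\<^sup>+z'. ennreal (1 - \<alpha>) * ennreal (X z z' powr p) + ennreal \<alpha> * ennreal (Y z z' powr p) \<partial>\<pi>) \<partial>\<pi>)"
      using \<alpha> assms by (intro nn_integral_mono)
        (auto simp flip: ennreal_mult ennreal_plus intro!: ennreal_leI powr_convex_combination_le)
    also have "\<dots> = ennreal (1 - \<alpha>) * A \<pi> + ennreal \<alpha> * (\<integral>\<^sup>+z. (\<integral>\<^sup>+z'. ennreal (Y z z' powr p) \<partial>\<pi>) \<partial>\<pi>)"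
      by (simp add: nn_integral_add nn_integral_cmult A_def)
    also have "\<dots> \<le> ennreal (1 - \<alpha>) * A \<pi> + ennreal \<alpha> * B"
      by (intro add_left_mono mult_left_mono B(2)[OF \<pi>]) simp
    finally show ?thesis .
  qed
  have lower: "ennreal ((1 - \<alpha>) powr p) * ?J \<le> ?I \<alpha>" if \<alpha>: "0 \<le> \<alpha> \<and> \<alpha> \<le> 1" for \<alpha>
  proof (rule INF_greatest)
    fix \<pi> assume \<pi>: "\<pi> \<in> C"
    interpret prob_space \<pi> by (rule prob[OF \<pi>])
    note [measurable_cong] = sets[OF \<pi>]
    have "ennreal ((1 - \<alpha>) powr p) * ?J \<le> ennreal ((1 - \<alpha>) powr p) * A \<pi>"
      unfolding A_def by (intro mult_left_mono INF_lower \<pi>) simp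
    also have "\<dots> = (\<integral>\<^sup>+z. (\<integral>\<^sup>+z'. ennreal (((1 - \<alpha>) * X z z') powr p) \<partial>\<pi>) \<partial>\<pi>)"
      using \<alpha> assms by (simp add: A_def powr_mult ennreal_mult nn_integral_cmult)
    also have "\<dots> \<le> (\<integral>\<^sup>+z. (\<integral>\<^sup>+z'. ennreal (((1 - \<alpha>) * X z z' + \<alpha> * Y z z') powr p) \<partial>\<pi>) \<partial>\<pi>)"
      using \<alpha> assms by (intro nn_integral_mono ennreal_leI powr_mono2) auto
    finally show "ennreal ((1 - \<alpha>) powr p) * ?J \<le> \<dots>" .
  qed
  obtain x where x: "?J = ennreal x" "0 \<le> x" using J by (cases ?J) auto
  obtain y where y: "B = ennreal y" "0 \<le> y" using B(1) by (cases B) auto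
  {
    fix a assume "a < ?J"
    have "((\<lambda>\<alpha>. ennreal ((1 - \<alpha>) powr p * x)) \<longlongrightarrow> ennreal ((1 - 0) powr p * x)) (at 0 within {0..1})"
      by (intro tendsto_ennrealI tendsto_intros) auto
    then have "\<forall>\<^sub>F \<alpha> in at 0 within {0..1}. a < ennreal ((1 - \<alpha>) powr p * x)"
      by (rule order_tendstoD(1)) (use \<open>a < ?J\<close> x in simp)
    with ev show "\<forall>\<^sub>F \<alpha> in at 0 within {0..1}. a < ?I \<alpha>"
      by eventually_elim (use lower x in \<open>auto simp: ennreal_mult intro: less_le_trans\<close>)
  next
    \<comment> \<open>A coupling with cost below \<open>a\<close> is fixed before \<alpha> tends to
      0; its upper bound then tends to \<open>A \<pi>\<close>, which is below
      \<open>a\<close>.\<close>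
    fix a assume "?J < a"
    then obtain \<pi> where \<pi>: "\<pi> \<in> C" "A \<pi> < a"
      unfolding A_def by (auto simp: INF_less_iff)
    then obtain u where u: "A \<pi> = ennreal u" "0 \<le> u" by (cases "A \<pi>") auto
    have "((\<lambda>\<alpha>. ennreal ((1 - \<alpha>) * u + \<alpha> * y)) \<longlongrightarrow> ennreal ((1 - 0) * u + 0 * y)) (at 0 within {0..1})"
      by (intro tendsto_ennrealI tendsto_intros)
    then have "\<forall>\<^sub>F \<alpha> in at 0 within {0..1}. ennreal ((1 - \<alpha>) * u + \<alpha> * y) < a"
      by (rule order_tendstoD(2)) (use \<pi> u in simp)
    with ev show "\<forall>\<^sub>F \<alpha> in at 0 within {0..1}. ?I \<alpha> < a"
      by eventually_elim (use upper[OF \<pi>(1)] u y in \<open>auto simp: ennreal_mult ennreal_plus intro: le_less_trans\<close>)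
  }
qed

text \<open>A finite limit makes \<open>f\<close> eventually finite, so near the limit
  \<open>ennreal_powr\<close> is the real power, which is continuous also at 0 for a positive
  exponent.\<close>

lemma tendsto_ennreal_powr:
  assumes "(f \<longlongrightarrow> L) F" "L < \<infinity>" "0 < s"
  shows "((\<lambda>x. ennreal_powr (f x) s) \<longlongrightarrow> ennreal_powr L s) F"
proof -
  obtain l where l: "L = ennreal l" "0 \<le> l" using assms(2) by (cases L) auto
  have "((\<lambda>x. enn2real (f x)) \<longlongrightarrow> l) F"
    using assms(1) l by (auto intro: tendsto_enn2real)
  then have "((\<lambda>x. ennreal (enn2real (f x) powr s)) \<longlongrightarrow> ennreal (l powr s)) F"
    using assms(3) by (intro tendsto_ennrealI tendsto_powr') auto
  moreover have "\<forall>\<^sub>F x in F. ennreal (enn2real (f x) powr s) = ennreal_powr (f x) s"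
    using order_tendstoD(2)[OF assms(1,2)] by eventually_elim (simp add: ennreal_powr_def)
  ultimately show ?thesis
    using l by (simp add: ennreal_powr_def tendsto_cong)
qed

lemma ennreal_powr_powr:
  assumes "0 < s" "0 < t"
  shows "ennreal_powr (ennreal_powr x s) t = ennreal_powr x (s * t)"
  by (simp add: ennreal_powr_def powr_powr)

section \<open>Moment bounds uniform in the coupling\<close>

text \<open>For nonnegative \<open>u\<close> and \<open>v\<close>, the difference is at most their
  maximum in absolute value, so its power is at most the sum of the two powers. Each summand depends
  on one marginal only, so its double integral is the same for every coupling and finite by
  assumption.\<close>

lemma structure_cost_bounded:
  fixes \<mu> :: "('x::polish_space \<times> 'w::polish_space) measure"
    and \<nu> :: "('y::polish_space \<times> 'w) measure"
  assumes "0 \<le> r" "\<mu> \<in> structured_space r" "\<nu> \<in> structured_space r"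
  shows "\<exists>B<\<infinity>. \<forall>\<pi>\<in>couplings \<mu> \<nu>.
    (\<integral>\<^sup>+z. (\<integral>\<^sup>+z'. ennreal (\<bar>dist (fst (fst z)) (fst (fst z')) - dist (fst (snd z)) (fst (snd z'))\<bar> powr r) \<partial>\<pi>) \<partial>\<pi>) \<le> B"
proof -
  define dX where "dX M = (\<integral>\<^sup>+x. (\<integral>\<^sup>+x'. ennreal (dist x x' powr r) \<partial>M) \<partial>M)" for M :: "'x measure"
  define dY where "dY M = (\<integral>\<^sup>+x. (\<integral>\<^sup>+x'. ennreal (dist x x' powr r) \<partial>M) \<partial>M)" for M :: "'y measure"
  show ?thesis
  proof (intro exI[of _ "dX (structure_marginal \<mu>) + dY (structure_marginal \<nu>)"] conjI ballI)
    show "dX (structure_marginal \<mu>) + dY (structure_marginal \<nu>) < \<infinity>"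
      using assms(2,3) by (simp add: structured_space_def dX_def dY_def)
    fix \<pi> assume \<pi>: "\<pi> \<in> couplings \<mu> \<nu>"
    \<comment> \<open>Unfolding the Borel sets of both factors into product sigma-algebras lets the
      measurability prover handle the nested projections.\<close>
    note [measurable_cong] = sets_coupling_pair[OF \<pi>, folded borel_prod[where 'a='x and 'b='w] borel_prod[where 'a='y and 'b='w]]
    interpret prob_space \<pi> by (rule couplingD[OF \<pi>])
    have X: "structure_marginal \<mu> = distr \<pi> borel (\<lambda>z. fst (fst z))"
      unfolding structure_marginal_def couplingD(3)[OF \<pi>, symmetric] borel_prod[symmetric]
      by (subst distr_distr) (simp_all add: comp_def)
    have Y: "structure_marginal \<nu> = distr \<pi> borel (\<lambda>z. fst (snd z))"
      unfolding structure_marginal_def couplingD(4)[OF \<pi>, symmetric] borel_prod[symmetric]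
      by (subst distr_distr) (simp_all add: comp_def)
    have le: "\<bar>u - v\<bar> powr r \<le> u powr r + v powr r" if "0 \<le> u" "0 \<le> v" for u v :: real
    proof -
      have "\<bar>u - v\<bar> powr r \<le> max u v powr r" using that assms by (intro powr_mono2) auto
      also have "\<dots> \<le> u powr r + v powr r" by (simp add: max_def)
      finally show ?thesis .
    qed
    interpret X: prob_space "structure_marginal \<mu>" unfolding X by (rule prob_space_distr) measurable
    interpret Y: prob_space "structure_marginal \<nu>" unfolding Y by (rule prob_space_distr) measurable
    have [measurable_cong]: "sets (structure_marginal \<mu>) = sets borel" "sets (structure_marginal \<nu>) = sets borel"
      by (simp_all add: structure_marginal_def)
    have "(\<integral>\<^sup>+z. (\<integral>\<^sup>+z'. ennreal (\<bar>dist (fst (fst z)) (fst (fst z')) - dist (fst (snd z)) (fst (snd z'))\<bar> powr r) \<partial>\<pi>) \<partial>\<pi>)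
      \<le> (\<integral>\<^sup>+z. (\<integral>\<^sup>+z'. ennreal (dist (fst (fst z)) (fst (fst z')) powr r) + ennreal (dist (fst (snd z)) (fst (snd z')) powr r) \<partial>\<pi>) \<partial>\<pi>)"
      by (intro nn_integral_mono) (simp add: le flip: ennreal_plus)
    also have "\<dots> = (\<integral>\<^sup>+z. (\<integral>\<^sup>+z'. ennreal (dist (fst (fst z)) (fst (fst z')) powr r) \<partial>\<pi>) \<partial>\<pi>)
      + (\<integral>\<^sup>+z. (\<integral>\<^sup>+z'. ennreal (dist (fst (snd z)) (fst (snd z')) powr r) \<partial>\<pi>) \<partial>\<pi>)"
      by (simp add: nn_integral_add)
    also have "(\<integral>\<^sup>+z. (\<integral>\<^sup>+z'. ennreal (dist (fst (fst z)) (fst (fst z')) powr r) \<partial>\<pi>) \<partial>\<pi>) = dX (structure_marginal \<mu>)"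
    proof -
      have push: "(\<integral>\<^sup>+x. G x \<partial>structure_marginal \<mu>) = (\<integral>\<^sup>+z. G (fst (fst z)) \<partial>\<pi>)"
        if [measurable]: "G \<in> borel_measurable borel" for G
        unfolding X by (rule nn_integral_distr) measurable
      show ?thesis unfolding dX_def
        by (subst push) (simp_all add: push)
    qed
    also have "(\<integral>\<^sup>+z. (\<integral>\<^sup>+z'. ennreal (dist (fst (snd z)) (fst (snd z')) powr r) \<partial>\<pi>) \<partial>\<pi>) = dY (structure_marginal \<nu>)"
    proof -
      have push: "(\<integral>\<^sup>+x. G x \<partial>structure_marginal \<nu>) = (\<integral>\<^sup>+z. G (fst (snd z)) \<partial>\<pi>)"
        if [measurable]: "G \<in> borel_measurable borel" for G
        unfolding Y by (rule nn_integral_distr) measurable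
      show ?thesis unfolding dY_def
        by (subst push) (simp_all add: push)
    qed
    finally show "(\<integral>\<^sup>+z. (\<integral>\<^sup>+z'. ennreal (\<bar>dist (fst (fst z)) (fst (fst z')) - dist (fst (snd z)) (fst (snd z'))\<bar> powr r) \<partial>\<pi>) \<partial>\<pi>)
      \<le> dX (structure_marginal \<mu>) + dY (structure_marginal \<nu>)" .
  qed
qed

text \<open>The base points of the two moment conditions may differ, so the triangle inequality goes
  through both. The sum of three distances is at most 3 times their maximum, whence the factor
  \<open>3 powr r\<close>, and the integral of the resulting bound depends on the marginals
  only.\<close>

lemma feature_cost_bounded:
  fixes \<mu> :: "('x::polish_space \<times> 'w::polish_space) measure"
    and \<nu> :: "('y::polish_space \<times> 'w) measure"
  assumes "0 \<le> r" "\<mu> \<in> structured_space r" "\<nu> \<in> structured_space r"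
  shows "\<exists>B<\<infinity>. \<forall>\<pi>\<in>couplings \<mu> \<nu>.
    (\<integral>\<^sup>+z. ennreal (dist (snd (fst z)) (snd (snd z)) powr r) \<partial>\<pi>) \<le> B"
proof -
  obtain a0 where a0: "(\<integral>\<^sup>+a. ennreal (dist a a0 powr r) \<partial>feature_marginal \<mu>) < \<infinity>"
    using assms(2) by (auto simp: structured_space_def)
  obtain b0 where b0: "(\<integral>\<^sup>+b. ennreal (dist b b0 powr r) \<partial>feature_marginal \<nu>) < \<infinity>"
    using assms(3) by (auto simp: structured_space_def)
  define B where "B = ennreal (3 powr r) * ((\<integral>\<^sup>+a. ennreal (dist a a0 powr r) \<partial>feature_marginal \<mu>)
    + ennreal (dist a0 b0 powr r) + (\<integral>\<^sup>+b. ennreal (dist b b0 powr r) \<partial>feature_marginal \<nu>))"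
  show ?thesis
  proof (intro exI[of _ B] conjI ballI)
    show "B < \<infinity>" using a0 b0 by (simp add: B_def ennreal_mult_less_top)
    fix \<pi> assume \<pi>: "\<pi> \<in> couplings \<mu> \<nu>"
    note [measurable_cong] = sets_coupling_pair[OF \<pi>, folded borel_prod[where 'a='x and 'b='w] borel_prod[where 'a='y and 'b='w]]
    interpret prob_space \<pi> by (rule couplingD[OF \<pi>])
    have A: "feature_marginal \<mu> = distr \<pi> borel (\<lambda>z. snd (fst z))"
      unfolding feature_marginal_def couplingD(3)[OF \<pi>, symmetric] borel_prod[symmetric]
      by (subst distr_distr) (simp_all add: comp_def)
    have B: "feature_marginal \<nu> = distr \<pi> borel (\<lambda>z. snd (snd z))"
      unfolding feature_marginal_def couplingD(4)[OF \<pi>, symmetric] borel_prod[symmetric]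
      by (subst distr_distr) (simp_all add: comp_def)
    have le: "dist a b powr r \<le> 3 powr r * (dist a a0 powr r + dist a0 b0 powr r + dist b b0 powr r)" for a b :: 'w
    proof -
      define m where "m = max (dist a a0) (max (dist a0 b0) (dist b b0))"
      have "dist a b \<le> dist a a0 + dist a0 b0 + dist b b0"
        using dist_triangle[of a b a0] dist_triangle[of a0 b b0] by (simp add: dist_commute)
      also have "\<dots> \<le> 3 * m" by (simp add: m_def)
      finally have "dist a b powr r \<le> (3 * m) powr r" using assms by (intro powr_mono2) auto
      also have "\<dots> = 3 powr r * m powr r" by (simp add: powr_mult)
      also have "m powr r \<le> dist a a0 powr r + dist a0 b0 powr r + dist b b0 powr r"
        by (auto simp: m_def max_def)
      finally show ?thesis by simp
    qed
    have "(\<integral>\<^sup>+z. ennreal (dist (snd (fst z)) (snd (snd z)) powr r) \<partial>\<pi>)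
      \<le> (\<integral>\<^sup>+z. ennreal (3 powr r) * (ennreal (dist (snd (fst z)) a0 powr r) + ennreal (dist a0 b0 powr r)
          + ennreal (dist (snd (snd z)) b0 powr r)) \<partial>\<pi>)"
      by (intro nn_integral_mono) (simp add: le flip: ennreal_plus ennreal_mult)
    also have "\<dots> = B"
      unfolding B_def A B
      by (simp add: nn_integral_add nn_integral_cmult nn_integral_distr emeasure_space_1)
    finally show "(\<integral>\<^sup>+z. ennreal (dist (snd (fst z)) (snd (snd z)) powr r) \<partial>\<pi>) \<le> B" .
  qed
qed

section \<open>The two limits of the fused cost\<close>

theorem proposition3p5p2:
  fixes p q :: real
    and \<mu> :: "('x::polish_space \<times> 'w::polish_space) measure"
    and \<nu> :: "('y::polish_space \<times> 'w) measure"
  assumes "p \<ge> 1" and "q \<ge> 1"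
    and "\<mu> \<in> structured_space (p * q)"
    and "\<nu> \<in> structured_space (p * q)"
  shows "((\<lambda>\<alpha>. FGW \<alpha> p q \<mu> \<nu>) \<longlongrightarrow>
            ennreal_powr (wasserstein (p * q) (feature_marginal \<mu>) (feature_marginal \<nu>)) q)
           (at 0 within {0..1})
       \<and> ((\<lambda>\<alpha>. FGW \<alpha> p q \<mu> \<nu>) \<longlongrightarrow>
            ennreal_powr (gromov_wasserstein (p * q) (structure_marginal \<mu>) (structure_marginal \<nu>)) q)
           (at 1 within {0..1})"
proof -
  \<comment> \<open>\<open>X\<close> ignores its second argument; it takes two so that both costs
    have the shape required by \<open>tendsto_interpolated_INF\<close>.\<close>
  define X :: "('x \<times> 'w) \<times> ('y \<times> 'w) \<Rightarrow> ('x \<times> 'w) \<times> ('y \<times> 'w) \<Rightarrow> real"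
    where "X z z' = dist (snd (fst z)) (snd (snd z)) powr q" for z z'
  define Y :: "('x \<times> 'w) \<times> ('y \<times> 'w) \<Rightarrow> ('x \<times> 'w) \<times> ('y \<times> 'w) \<Rightarrow> real"
    where "Y z z' = \<bar>dist (fst (fst z)) (fst (fst z')) - dist (fst (snd z)) (fst (snd z'))\<bar> powr q" for z z'
  define cost where "cost \<alpha> = (INF \<pi>\<in>couplings \<mu> \<nu>. \<integral>\<^sup>+z. (\<integral>\<^sup>+z'. ennreal (((1 - \<alpha>) * X z z' + \<alpha> * Y z z') powr p) \<partial>\<pi>) \<partial>\<pi>)" for \<alpha>
  define A where "A \<pi> = (\<integral>\<^sup>+z. (\<integral>\<^sup>+z'. ennreal (X z z' powr p) \<partial>\<pi>) \<partial>\<pi>)" for \<pi>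
  define S where "S \<pi> = (\<integral>\<^sup>+z. (\<integral>\<^sup>+z'. ennreal (Y z z' powr p) \<partial>\<pi>) \<partial>\<pi>)" for \<pi>
  have pq: "1 \<le> p * q" using assms(1,2) mult_mono[of 1 p 1 q] by simp
  then have pq0: "0 \<le> p * q" by simp
  have \<mu>: "prob_space \<mu>" "sets \<mu> = sets borel" and \<nu>: "prob_space \<nu>" "sets \<nu> = sets borel"
    using assms(3,4) by (auto simp: structured_space_def structured_object_def)
  have FGW: "FGW \<alpha> p q \<mu> \<nu> = ennreal_powr (cost \<alpha>) (1 / p)" for \<alpha>
    by (simp add: FGW_def cost_def X_def Y_def case_prod_unfold)
  have Xp: "X z z' powr p = dist (snd (fst z)) (snd (snd z)) powr (p * q)"
    and Yp: "Y z z' powr p = \<bar>dist (fst (fst z)) (fst (fst z')) - dist (fst (snd z)) (fst (snd z'))\<bar> powr (p * q)" for z z'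
    by (simp_all add: X_def Y_def powr_powr mult.commute)
  obtain BX where BX: "BX < \<infinity>"
    "\<forall>\<pi>\<in>couplings \<mu> \<nu>. (\<integral>\<^sup>+z. ennreal (dist (snd (fst z)) (snd (snd z)) powr (p * q)) \<partial>\<pi>) \<le> BX"
    using feature_cost_bounded[OF pq0 assms(3,4)] by blast
  \<comment> \<open>The inner integrand is constant in \<open>z'\<close>, so under a probability
    measure the double integral collapses to a single one.\<close>
  have A_le: "A \<pi> \<le> BX" if "\<pi> \<in> couplings \<mu> \<nu>" for \<pi>
    using BX(2)[rule_format, OF that] prob_space.emeasure_space_1[OF couplingD(1)[OF that]]
    by (simp add: A_def Xp)
  obtain BY where BY: "BY < \<infinity>" "\<forall>\<pi>\<in>couplings \<mu> \<nu>. S \<pi> \<le> BY"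
    using structure_cost_bounded[OF pq0 assms(3,4)] unfolding S_def Yp by blast
  obtain \<pi>0 where \<pi>0: "\<pi>0 \<in> couplings \<mu> \<nu>" using couplings_nonempty[OF \<mu> \<nu>] by blast
  have INF_A: "(INF \<pi>\<in>couplings \<mu> \<nu>. A \<pi>) < \<infinity>" and INF_S: "(INF \<pi>\<in>couplings \<mu> \<nu>. S \<pi>) < \<infinity>"
    using BX(1) A_le BY \<pi>0 by (auto simp: INF_less_iff intro: le_less_trans)
  have [measurable]: "case_prod X \<in> borel_measurable (borel \<Otimes>\<^sub>M borel)" "case_prod Y \<in> borel_measurable (borel \<Otimes>\<^sub>M borel)"
    unfolding X_def Y_def case_prod_unfold borel_prod[symmetric] by measurable
  have proj: "fst \<in> (borel :: ('x \<times> 'w) measure) \<rightarrow>\<^sub>M borel" "snd \<in> (borel :: ('x \<times> 'w) measure) \<rightarrow>\<^sub>M borel"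
    "fst \<in> (borel :: ('y \<times> 'w) measure) \<rightarrow>\<^sub>M borel" "snd \<in> (borel :: ('y \<times> 'w) measure) \<rightarrow>\<^sub>M borel"
    unfolding borel_prod[symmetric] by measurable
  have dist_lip: "dist a b \<le> dist a' b' + (dist a a' + dist b b')" for a b a' b' :: "'c::metric_space"
    using dist_triangle[of a b a'] dist_triangle[of a' b b'] by (simp add: dist_commute)
  have features: "(INF \<pi>\<in>couplings \<mu> \<nu>. A \<pi>)
      = (INF \<gamma>\<in>couplings (feature_marginal \<mu>) (feature_marginal \<nu>). \<integral>\<^sup>+(a, b). ennreal (dist a b powr (p * q)) \<partial>\<gamma>)"
  proof -
    have "(INF \<pi>\<in>couplings \<mu> \<nu>. A \<pi>) = (INF \<gamma>\<in>couplings (feature_marginal \<mu>) (feature_marginal \<nu>).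
        \<integral>\<^sup>+w. (\<integral>\<^sup>+w'. ennreal (dist (fst w) (snd w) powr (p * q)) \<partial>\<gamma>) \<partial>\<gamma>)"
      unfolding A_def Xp feature_marginal_def
    proof (rule INF_couplings_projection[OF \<mu> \<nu> proj(2,4), where k = "\<lambda>w w'. dist (fst w) (snd w)", simplified fst_conv snd_conv])
      show "dist u v \<le> dist x y + (dist u x + dist v y + dist u' x' + dist v' y')" for u v u' v' x y x' y' :: 'w
        using dist_lip[of u v x y] zero_le_dist[of u' x'] zero_le_dist[of v' y'] by linarith
    qed (use pq in \<open>simp_all\<close>)
    also have "\<dots> = (INF \<gamma>\<in>couplings (feature_marginal \<mu>) (feature_marginal \<nu>). \<integral>\<^sup>+(a, b). ennreal (dist a b powr (p * q)) \<partial>\<gamma>)"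
      by (intro INF_cong refl) (simp add: case_prod_unfold prob_space.emeasure_space_1[OF couplingD(1)])
    finally show ?thesis .
  qed
  have structures: "(INF \<pi>\<in>couplings \<mu> \<nu>. S \<pi>)
      = (INF \<gamma>\<in>couplings (structure_marginal \<mu>) (structure_marginal \<nu>).
          \<integral>\<^sup>+(x, y). (\<integral>\<^sup>+(x', y'). ennreal (\<bar>dist x x' - dist y y'\<bar> powr (p * q)) \<partial>\<gamma>) \<partial>\<gamma>)"
    unfolding S_def Yp structure_marginal_def case_prod_unfold
  proof (rule INF_couplings_projection[OF \<mu> \<nu> proj(1,3),
        where k = "\<lambda>w w'. \<bar>dist (fst w) (fst w') - dist (snd w) (snd w')\<bar>", simplified fst_conv snd_conv])
    show "\<bar>dist u u' - dist v v'\<bar> \<le> \<bar>dist x x' - dist y y'\<bar> + (dist u x + dist v y + dist u' x' + dist v' y')"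
      for u u' x x' :: 'x and v v' y y' :: 'y
      using dist_lip[of u u' x x'] dist_lip[of x x' u u'] dist_lip[of v v' y y'] dist_lip[of y y' v v']
      by (simp add: dist_commute[of x u] dist_commute[of x' u'] dist_commute[of y v] dist_commute[of y' v'])
  qed (use pq in \<open>simp_all\<close>)
  \<comment> \<open>The exponents \<open>1 / (p * q)\<close> and \<open>q\<close> compose to
    \<open>1 / p\<close>, the outer exponent of \<open>FGW\<close>, so it remains to pass to the
    limit in \<open>cost\<close>.\<close>
  have wasserstein: "ennreal_powr (wasserstein (p * q) (feature_marginal \<mu>) (feature_marginal \<nu>)) q
      = ennreal_powr (INF \<pi>\<in>couplings \<mu> \<nu>. A \<pi>) (1 / p)"
    and gromov_wasserstein: "ennreal_powr (gromov_wasserstein (p * q) (structure_marginal \<mu>) (structure_marginal \<nu>)) q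
      = ennreal_powr (INF \<pi>\<in>couplings \<mu> \<nu>. S \<pi>) (1 / p)"
    using assms(1,2) pq
    by (simp_all add: wasserstein_def gromov_wasserstein_def ennreal_powr_powr features structures)
  have "(cost \<longlongrightarrow> (INF \<pi>\<in>couplings \<mu> \<nu>. A \<pi>)) (at 0 within {0..1})"
    unfolding cost_def A_def
    by (rule tendsto_interpolated_INF[OF assms(1) _ _ couplingD(1,2) _ _ BY(1) BY(2)[unfolded S_def, rule_format]])
       (use INF_A in \<open>simp_all add: A_def\<close>, simp_all add: X_def Y_def)
  then have FGW0: "((\<lambda>\<alpha>. FGW \<alpha> p q \<mu> \<nu>) \<longlongrightarrow> ennreal_powr (INF \<pi>\<in>couplings \<mu> \<nu>. A \<pi>) (1 / p)) (at 0 within {0..1})"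
    unfolding FGW using INF_A assms(1) by (intro tendsto_ennreal_powr) auto
  \<comment> \<open>Substituting \<beta> for \<open>1 - \<alpha>\<close> exchanges the weights of
    \<open>X\<close> and \<open>Y\<close>, which turns the limit at 1 into a limit at 0.\<close>
  have "((\<lambda>\<beta>. cost (1 - \<beta>)) \<longlongrightarrow> (INF \<pi>\<in>couplings \<mu> \<nu>. S \<pi>)) (at 0 within {0..1})"
  proof -
    have cost': "cost (1 - \<beta>) = (INF \<pi>\<in>couplings \<mu> \<nu>. \<integral>\<^sup>+z. (\<integral>\<^sup>+z'. ennreal (((1 - \<beta>) * Y z z' + \<beta> * X z z') powr p) \<partial>\<pi>) \<partial>\<pi>)" for \<beta>
      by (simp add: cost_def add.commute)
    show ?thesis
      unfolding cost' S_def
      by (rule tendsto_interpolated_INF[OF assms(1) _ _ couplingD(1,2) _ _ BX(1) A_le[unfolded A_def]])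
         (use INF_S in \<open>simp_all add: S_def\<close>, simp_all add: X_def Y_def)
  qed
  moreover have "filterlim (\<lambda>\<alpha>. 1 - \<alpha>) (at 0 within {0..1}) (at (1::real) within {0..1})"
    by (auto simp: filterlim_at eventually_at_filter intro!: tendsto_eq_intros)
  ultimately have "(cost \<longlongrightarrow> (INF \<pi>\<in>couplings \<mu> \<nu>. S \<pi>)) (at 1 within {0..1})"
    by (auto dest: filterlim_compose)
  then have "((\<lambda>\<alpha>. FGW \<alpha> p q \<mu> \<nu>) \<longlongrightarrow> ennreal_powr (INF \<pi>\<in>couplings \<mu> \<nu>. S \<pi>) (1 / p)) (at 1 within {0..1})"
    unfolding FGW using INF_S assms(1) by (intro tendsto_ennreal_powr) auto
  with FGW0 show ?thesis
    unfolding wasserstein gromov_wasserstein by simp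
qed

end
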